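(* Let $(M,\mathcal{M},\mu)$ be an arbitrary $\sigma$-finite measure space, and let $\mathfrak{Z}$ be an $\mathbb{F}$-Fréchet space. Consider a sequence of functions $\psi_k:M\to\mathfrak{Z}'$, $k\in\mathbb{N}$, and $\psi:M\to\mathfrak{Z}'$ such that (i) for any $k\in\mathbb{N}$ the function $\psi_k$ is $\mathfrak{Z}'$-Gelfand $\mu$-integrable; (ii) for any $z\in\mathfrak{Z}$ the function $x\mapsto\langle\psi(x),z\rangle$ is $\mu$-measurable; (iii) for $\mu$-a.e. $x\in M$, $\psi_k(x)\to\psi(x)$ in $(\mathfrak{Z}',\sigma(\mathfrak{Z}',\mathfrak{Z}))$ as $k\to\infty$; (iv) for any $z\in\mathfrak{Z}$ and $\varepsilon>0$ there exists $E_{\varepsilon,z}\in\mathcal{M}$ with $\mu(E_{\varepsilon,z})<\infty$ such that for all $G\in\mathcal{M}$ with $G\cap E_{\varepsilon,z}=\emptyset$ it holds $\sup_k\int_G|\langle\psi_k(x),z\rangle|\,\mu(dx)<\varepsilon$; (v) for any $z\in\mathfrak{Z}$ and $\varepsilon>0$ there exists $\delta_{\varepsilon,z}>0$ such that for all $E\in\mathcal{M}$ with $\mu(E)<\delta_{\varepsilon,z}$ it holds $\sup_k\int_E|\langle\psi_k(x),z\rangle|\,\mu(dx)<\varepsilon$. Then $\psi$ is $\mathfrak{Z}'$-Gelfand $\mu$-integrable, and as $k\to\infty$ $$\int_M\psi_k(x)\,\mu(dx)\to\int_M\psi(x)\,\mu(dx)\quad\text{in }(\mathfrak{Z}',\s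igma(\mathfrak{Z}',\mathfrak{Z})).$$
   Context: $\mathbb{F}\in\{\mathbb{R},\mathbb{C}\}$. A Fréchet space is a metrizable, complete, locally convex topological vector space over $\mathbb{F}$; $\mathfrak{Z}'$ is its topological dual and $\langle z',z\rangle$ the dual pairing of $z'\in\mathfrak{Z}'$, $z\in\mathfrak{Z}$. $\sigma(\mathfrak{Z}',\mathfrak{Z})$ is the weak star topology on $\mathfrak{Z}'$, i.e. the coarsest topology making all maps $z'\mapsto\langle z',z\rangle$, $z\in\mathfrak{Z}$, continuous. A map $\psi:M\to\mathfrak{Z}'$ is $\mathfrak{Z}'$-Gelfand $\mu$-integrable if $x\mapsto\langle\psi(x),z\rangle$ belongs to $L^1(\mu)$ for every $z\in\mathfrak{Z}$. For such $\psi$ and $E\in\mathcal{M}$, the Gelfand integral $\int_E\psi(x)\,\mu(dx)$ is the element of $\mathfrak{Z}'$ given by $z\mapsto\int_E\langle\psi(x),z\rangle\,\mu(dx)$ (this functional is continuous). *)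

theory Defs
  imports "HOL-Analysis.Analysis"
begin

(* The scalar field: real and complex belong to this class, and up to isometric
   isomorphism they are its only members (a finite-dimensional field extension of the
   reals is real or complex, and multiplicativity of the norm determines the norm). *)
class rc_field = real_normed_field + euclidean_space

instance real :: rc_field ..
instance complex :: rc_field ..

(* Completeness refers to the translation-invariant uniformity of the topological vector
   space, not to some metric inducing the topology.  By metrizability it is enough to
   demand convergence of Cauchy sequences. *)
locale frechet_space = vector_space smul
  for smul :: "'f::rc_field \<Rightarrow> 'z::topological_ab_group_add \<Rightarrow> 'z" +
  assumes continuous_smul: "continuous_on UNIV (\<lambda>(a, z). smul a z)"
    and locally_convex:
      "\<And>U. open U \<Longrightarrow> 0 \<in> U \<Longrightarrow>
        \<exists>V. open V \<and> 0 \<in> V \<and> V \<subseteq> U \<and>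
          (\<forall>x\<in>V. \<forall>y\<in>V. \<forall>t\<in>{0..1::real}.
             smul (of_real (1 - t)) x + smul (of_real t) y \<in> V)"
    and metrizable: "metrizable_space (euclidean :: 'z topology)"
    and complete:
      "\<And>s :: nat \<Rightarrow> 'z.
        (\<And>U. open U \<Longrightarrow> 0 \<in> U \<Longrightarrow> \<exists>N. \<forall>m\<ge>N. \<forall>n\<ge>N. s m - s n \<in> U) \<Longrightarrow>
        \<exists>l. s \<longlonglongrightarrow> l"

definition topological_dual ::
    "('f::rc_field \<Rightarrow> 'z::topological_ab_group_add \<Rightarrow> 'z) \<Rightarrow> ('z \<Rightarrow> 'f) set" where
  "topological_dual smul =
     {z'. Vector_Spaces.linear smul (*) z' \<and> continuous_on UNIV z'}"

definition weak_star_topology ::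
    "('f::rc_field \<Rightarrow> 'z::topological_ab_group_add \<Rightarrow> 'z) \<Rightarrow> ('z \<Rightarrow> 'f) topology" where
  "weak_star_topology smul =
     topology_generated_by {{z' \<in> topological_dual smul. z' z \<in> U} | z U. open U}"

lemma topspace_weak_star_topology:
  "topspace (weak_star_topology smul) = topological_dual smul"
  unfolding weak_star_topology_def topology_generated_by_topspace
  by (auto intro!: exI[of _ "topological_dual smul"] exI[of _ UNIV])

lemma continuous_map_weak_star_eval:
  "continuous_map (weak_star_topology smul) euclidean (\<lambda>z'. z' z)"
  unfolding continuous_map_def topspace_weak_star_topology
  by (auto simp: weak_star_topology_def intro!: topology_generated_by_Basis)

lemma weak_star_topology_coarsest:
  assumes "topspace X = topological_dual smul"
    and "\<And>z. continuous_map X euclidean (\<lambda>z'. z' z)"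
    and "openin (weak_star_topology smul) W"
  shows "openin X W"
proof -
  have "openin X S"
    if S: "S \<in> {{z' \<in> topological_dual smul. z' z \<in> U} | z U. open U}" for S
    using S assms(1,2) by (force simp: continuous_map_def)
  then show ?thesis
    using assms(3) generate_topology_on_coarsest[OF istopology_openin, of _ X W]
    unfolding weak_star_topology_def openin_topology_generated_by_iff by blast
qed

definition gelfand_integrable ::
    "'m measure \<Rightarrow> ('m \<Rightarrow> 'z \<Rightarrow> 'f::rc_field) \<Rightarrow> bool" where
  "gelfand_integrable M \<psi> \<longleftrightarrow> (\<forall>z. integrable M (\<lambda>x. \<psi> x z))"

(* As a function on 'z; membership in the topological dual is a fact about Gelfand
   integrable maps with values in the dual of a Frechet space. *)
definition gelfand_integral ::
    "'m measure \<Rightarrow> 'm set \<Rightarrow> ('m \<Rightarrow> 'z \<Rightarrow> 'f::rc_field) \<Rightarrow> 'z \<Rightarrow> 'f" where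
  "gelfand_integral M E \<psi> = (\<lambda>z. LINT x:E|M. \<psi> x z)"

end

theory Submission
  imports Defs
begin

text \<open>
  Tested against a single vector \<open>z\<close>, the hypotheses are those of the Vitali convergence
  theorem for the scalar functions \<open>\<psi>\<^sub>k(\<cdot>) z\<close>: almost everywhere convergence, uniform
  integrability, and tightness, the last of which replaces finiteness of the measure.
  So \<open>\<psi>(\<cdot>) z\<close> is integrable and the integrals converge (\<open>vitali_convergence\<close>).
  Because the weak star topology is the topology of pointwise convergence on the dual
  (\<open>limitin_weak_star_iff\<close>), it only remains to see that Gelfand integrals do belong to the
  dual, that is, that they are continuous (\<open>gelfand_integral_in_dual\<close>).

  This is where the Frechet property enters. For a Gelfand integrable \<open>\<phi>\<close> put
  \<open>p z = \<integral> \<bar>\<phi>(x) z\<bar> \<mu>(dx)\<close>. This seminorm is finite everywhere, and by Fatou's lemma its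
  sublevel sets are closed, since each \<open>\<phi>(x)\<close> is continuous. The space is the union of the
  sets \<open>{p \<le> n}\<close>, so by the Baire category theorem one of them has interior points;
  by subadditivity \<open>p\<close> is then bounded on a neighbourhood of \<open>0\<close>. Any Gelfand integral of \<open>\<phi>\<close>
  is a linear functional dominated by \<open>p\<close>, hence continuous.
\<close>

section \<open>Vitali convergence\<close>

text \<open>Fatou's lemma, in the form of lower semicontinuity of the integral.\<close>

lemma nn_integral_le_of_tendsto:
  fixes u :: "nat \<Rightarrow> 'm \<Rightarrow> ennreal"
  assumes [measurable]: "\<And>k. u k \<in> borel_measurable M"
    and lim: "AE x in M. (\<lambda>k. u k x) \<longlonglongrightarrow> v x"
    and le: "\<And>k. (\<integral>\<^sup>+x. u k x \<partial>M) \<le> c"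
  shows "(\<integral>\<^sup>+x. v x \<partial>M) \<le> c"
proof -
  have "(\<integral>\<^sup>+x. v x \<partial>M) = (\<integral>\<^sup>+x. liminf (\<lambda>k. u k x) \<partial>M)"
    using lim
    by (intro nn_integral_cong_AE) (auto elim!: eventually_mono simp: lim_imp_Liminf)
  also have "\<dots> \<le> liminf (\<lambda>k. \<integral>\<^sup>+x. u k x \<partial>M)"
    by (rule nn_integral_liminf) simp
  also have "\<dots> \<le> c"
    using le by (intro Liminf_le) auto
  finally show ?thesis .
qed

lemma set_nn_integral_norm_le_of_tendsto:
  fixes f :: "nat \<Rightarrow> 'm \<Rightarrow> 'b::{banach, second_countable_topology}"
  assumes [measurable]: "\<And>k. f k \<in> borel_measurable M" "A \<in> sets M"
    and lim: "AE x in M. (\<lambda>k. f k x) \<longlonglongrightarrow> g x"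
    and le: "\<And>k. (\<integral>\<^sup>+x\<in>A. ennreal (norm (f k x)) \<partial>M) \<le> c"
  shows "(\<integral>\<^sup>+x\<in>A. ennreal (norm (g x)) \<partial>M) \<le> c"
proof (rule nn_integral_le_of_tendsto[OF _ _ le])
  show "AE x in M. (\<lambda>k. ennreal (norm (f k x)) * indicator A x)
          \<longlonglongrightarrow> ennreal (norm (g x)) * indicator A x"
    using lim
  proof (rule eventually_mono)
    fix x assume "(\<lambda>k. f k x) \<longlonglongrightarrow> g x"
    then show "(\<lambda>k. ennreal (norm (f k x)) * indicator A x)
          \<longlonglongrightarrow> ennreal (norm (g x)) * indicator A x"
      by (cases "x \<in> A") (auto intro!: tendsto_ennrealI tendsto_norm)
  qed
qed simp

lemma emeasure_tendsto_0_of_eventually_notin: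
  assumes [measurable]: "\<And>k. A k \<in> sets M" "E \<in> sets M"
    and sub: "\<And>k. A k \<subseteq> E" and fin: "emeasure M E < \<infinity>"
    and ev: "AE x in M. \<forall>\<^sub>F k in sequentially. x \<notin> A k"
  shows "(\<lambda>k. emeasure M (A k)) \<longlonglongrightarrow> 0"
proof -
  have "(\<lambda>k. \<integral>\<^sup>+x. indicator (A k) x \<partial>M) \<longlonglongrightarrow> (\<integral>\<^sup>+x. 0 \<partial>M)"
  proof (rule nn_integral_dominated_convergence[where w = "indicator E"])
    show "AE x in M. indicator (A k) x \<le> (indicator E x :: ennreal)" for k
      using sub by (auto simp: indicator_def)
    show "AE x in M. (\<lambda>k. indicator (A k) x :: ennreal) \<longlonglongrightarrow> 0"
      using ev
      by (rule eventually_mono) (auto intro!: tendsto_eventually elim!: eventually_mono)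
  qed (use fin in auto)
  then show ?thesis by simp
qed

text \<open>
  The measure is arbitrary: \<open>tight\<close> says that the \<open>f k\<close> carry little mass outside a set of
  finite measure, uniformly in \<open>k\<close>, and \<open>unif\<close> is their uniform absolute continuity.
  Fatou's lemma passes both bounds on to \<open>g\<close>.
\<close>

theorem vitali_convergence:
  fixes f :: "nat \<Rightarrow> 'm \<Rightarrow> 'b::{banach, second_countable_topology}"
  assumes int: "\<And>k. integrable M (f k)"
    and meas [measurable]: "g \<in> borel_measurable M"
    and lim: "AE x in M. (\<lambda>k. f k x) \<longlonglongrightarrow> g x"
    and tight: "\<And>e. (e::real) > 0 \<Longrightarrow>
           \<exists>E\<in>sets M. emeasure M E < \<infinity> \<and>
             (\<forall>G\<in>sets M. G \<inter> E = {} \<longrightarrow>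
               (\<forall>k. (\<integral>\<^sup>+x\<in>G. ennreal (norm (f k x)) \<partial>M) \<le> ennreal e))"
    and unif: "\<And>e. (e::real) > 0 \<Longrightarrow>
           \<exists>d::real. d > 0 \<and>
             (\<forall>E\<in>sets M. emeasure M E < ennreal d \<longrightarrow>
               (\<forall>k. (\<integral>\<^sup>+x\<in>E. ennreal (norm (f k x)) \<partial>M) \<le> ennreal e))"
  shows "integrable M g" "(\<lambda>k. LINT x|M. f k x) \<longlonglongrightarrow> (LINT x|M. g x)"
proof -
  have [measurable]: "f k \<in> borel_measurable M" for k
    using int by (rule borel_measurable_integrable)
  note fatou = set_nn_integral_norm_le_of_tendsto[OF _ _ lim]

  show g: "integrable M g"
  proof -
    obtain E where [measurable]: "E \<in> sets M" and fin: "emeasure M E < \<infinity>"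
      and E: "\<And>G k. G \<in> sets M \<Longrightarrow> G \<inter> E = {} \<Longrightarrow>
                (\<integral>\<^sup>+x\<in>G. ennreal (norm (f k x)) \<partial>M) \<le> ennreal 1"
      using tight[of 1] by auto
    obtain d :: real where "d > 0"
      and d: "\<And>A k. A \<in> sets M \<Longrightarrow> emeasure M A < ennreal d \<Longrightarrow>
                (\<integral>\<^sup>+x\<in>A. ennreal (norm (f k x)) \<partial>M) \<le> ennreal 1"
      using unif[of 1] by auto
    \<comment> \<open>As \<open>g\<close> is finite everywhere, it is bounded on \<open>E\<close> off a set of small measure.\<close>
    define A where "A n = {x\<in>space M. x \<in> E \<and> norm (g x) > real n}" for n
    have A [measurable]: "A n \<in> sets M" for n
      unfolding A_def by measurable
    have "(\<lambda>n. emeasure M (A n)) \<longlonglongrightarrow> 0"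
    proof (rule emeasure_tendsto_0_of_eventually_notin[of _ _ E])
      show "AE x in M. \<forall>\<^sub>F n in sequentially. x \<notin> A n"
      proof (rule AE_I2)
        fix x
        obtain N where "norm (g x) \<le> real N" using real_arch_simple by blast
        then show "\<forall>\<^sub>F n in sequentially. x \<notin> A n"
          by (auto simp: A_def eventually_sequentially intro!: exI[of _ N])
      qed
    qed (use fin in \<open>auto simp: A_def\<close>)
    then have "\<forall>\<^sub>F n in sequentially. emeasure M (A n) < ennreal d"
      using \<open>d > 0\<close> by (intro order_tendstoD) auto
    then obtain n where n: "emeasure M (A n) < ennreal d"
      by (auto simp: eventually_sequentially)
    have 1: "(\<integral>\<^sup>+x\<in>space M - E. ennreal (norm (g x)) \<partial>M) \<le> ennreal 1"
      by (rule fatou[OF _ _ E]) auto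
    have 2: "(\<integral>\<^sup>+x\<in>A n. ennreal (norm (g x)) \<partial>M) \<le> ennreal 1"
      by (rule fatou[OF _ _ d[OF _ n]]) auto
    have "(\<integral>\<^sup>+x. ennreal (norm (g x)) \<partial>M)
        \<le> (\<integral>\<^sup>+x. ennreal (norm (g x)) * indicator (space M - E) x
            + (ennreal (norm (g x)) * indicator (A n) x + ennreal (real n) * indicator E x) \<partial>M)"
      by (intro nn_integral_mono) (auto simp: A_def indicator_def not_less)
    also have "\<dots> = (\<integral>\<^sup>+x\<in>space M - E. ennreal (norm (g x)) \<partial>M)
        + ((\<integral>\<^sup>+x\<in>A n. ennreal (norm (g x)) \<partial>M) + ennreal (real n) * emeasure M E)"
      by (simp add: nn_integral_add nn_integral_cmult_indicator)
    also have "\<dots> \<le> ennreal 1 + (ennreal 1 + ennreal (real n) * emeasure M E)"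
      by (intro add_mono 1 2 order_refl)
    also have "\<dots> < \<infinity>"
      using fin by (auto simp: ennreal_mult_less_top)
    finally show ?thesis by (auto intro: integrableI_bounded)
  qed

  have "(\<lambda>k. \<integral>\<^sup>+x. ennreal (norm (f k x - g x)) \<partial>M) \<longlonglongrightarrow> 0"
  proof (rule order_tendstoI)
    fix a :: ennreal assume "0 < a"
    then obtain e' :: real where e': "e' > 0" "ennreal e' < a"
      by (metis dense ennreal_cases ennreal_less_zero_iff less_top order_less_imp_not_less order_less_trans)
    \<comment> \<open>Five error terms: \<open>f k\<close> and \<open>g\<close>, each outside \<open>E\<close> and on the exceptional part of \<open>E\<close>,
      and the rest of \<open>E\<close>.\<close>
    define e where "e = e' / 5"
    have e: "e > 0" "ennreal (5 * e) < a"
      using e' by (auto simp: e_def)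
    obtain E where [measurable]: "E \<in> sets M" and fin: "emeasure M E < \<infinity>"
      and E: "\<And>G k. G \<in> sets M \<Longrightarrow> G \<inter> E = {} \<Longrightarrow>
                (\<integral>\<^sup>+x\<in>G. ennreal (norm (f k x)) \<partial>M) \<le> ennreal e"
      using tight[OF \<open>e > 0\<close>] by auto
    obtain d :: real where "d > 0"
      and d: "\<And>A k. A \<in> sets M \<Longrightarrow> emeasure M A < ennreal d \<Longrightarrow>
                (\<integral>\<^sup>+x\<in>A. ennreal (norm (f k x)) \<partial>M) \<le> ennreal e"
      using unif[OF \<open>e > 0\<close>] by auto
    \<comment> \<open>Where \<open>norm (f k x - g x) \<le> h\<close>, the integral over \<open>E\<close> is at most \<open>e\<close>; the summand \<open>1\<close>
      covers the case that \<open>E\<close> is a null set.\<close>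
    define h where "h = e / (measure M E + 1)"
    have "h > 0" using e by (simp add: h_def add_nonneg_pos)
    have hE: "ennreal h * emeasure M E \<le> ennreal e"
    proof -
      have "h * measure M E \<le> e"
        using mult_left_mono[of "measure M E" "measure M E + 1" h] \<open>h > 0\<close>
          measure_nonneg[of M E]
        by (simp add: h_def)
      then show ?thesis
        using fin \<open>h > 0\<close>
        by (simp add: emeasure_eq_ennreal_measure ennreal_mult[symmetric] ennreal_leI)
    qed
    define B where "B k = {x\<in>space M. x \<in> E \<and> norm (f k x - g x) > h}" for k
    have B [measurable]: "B k \<in> sets M" for k
      unfolding B_def by measurable
    have "(\<lambda>k. emeasure M (B k)) \<longlonglongrightarrow> 0"
    proof (rule emeasure_tendsto_0_of_eventually_notin[of _ _ E])
      show "AE x in M. \<forall>\<^sub>F k in sequentially. x \<notin> B k"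
        using lim
      proof (rule eventually_mono)
        fix x assume "(\<lambda>k. f k x) \<longlonglongrightarrow> g x"
        then have "\<forall>\<^sub>F k in sequentially. dist (f k x) (g x) < h"
          using \<open>h > 0\<close> by (rule tendstoD)
        then show "\<forall>\<^sub>F k in sequentially. x \<notin> B k"
          by (rule eventually_mono) (auto simp: B_def dist_norm)
      qed
    qed (use fin in \<open>auto simp: B_def\<close>)
    then have "\<forall>\<^sub>F k in sequentially. emeasure M (B k) < ennreal d"
      using \<open>d > 0\<close> by (intro order_tendstoD) auto
    then show "\<forall>\<^sub>F k in sequentially. (\<integral>\<^sup>+x. ennreal (norm (f k x - g x)) \<partial>M) < a"
    proof (rule eventually_mono)
      fix k assume k: "emeasure M (B k) < ennreal d"
      define S where "S = (space M - E) \<union> B k"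
      have [measurable]: "S \<in> sets M" by (simp add: S_def)
      have split: "(\<integral>\<^sup>+x\<in>S. u x \<partial>M)
          = (\<integral>\<^sup>+x\<in>space M - E. u x \<partial>M) + (\<integral>\<^sup>+x\<in>B k. u x \<partial>M)"
        if [measurable]: "u \<in> borel_measurable M" for u :: "'m \<Rightarrow> ennreal"
        unfolding S_def by (rule nn_integral_disjoint_pair) (auto simp: B_def)
      have outside: "(\<integral>\<^sup>+x\<in>space M - E. ennreal (norm (f j x)) \<partial>M) \<le> ennreal e" for j
        by (rule E) auto
      have inside: "(\<integral>\<^sup>+x\<in>B k. ennreal (norm (f j x)) \<partial>M) \<le> ennreal e" for j
        by (rule d[OF B k])
      have "(\<integral>\<^sup>+x\<in>S. ennreal (norm (f k x)) \<partial>M) \<le> ennreal e + ennreal e"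
        using add_mono[OF outside inside] by (simp add: split)
      moreover have "(\<integral>\<^sup>+x\<in>S. ennreal (norm (g x)) \<partial>M) \<le> ennreal e + ennreal e"
        using add_mono[OF fatou[OF _ _ outside] fatou[OF _ _ inside]] by (simp add: split)
      ultimately have *: "(\<integral>\<^sup>+x\<in>S. ennreal (norm (f k x)) \<partial>M)
          + (\<integral>\<^sup>+x\<in>S. ennreal (norm (g x)) \<partial>M) + ennreal h * emeasure M E
          \<le> (ennreal e + ennreal e) + (ennreal e + ennreal e) + ennreal e"
        by (intro add_mono hE)
      have "(\<integral>\<^sup>+x. ennreal (norm (f k x - g x)) \<partial>M)
          \<le> (\<integral>\<^sup>+x. ennreal (norm (f k x)) * indicator S x
            + ennreal (norm (g x)) * indicator S x + ennreal h * indicator E x \<partial>M)"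
      proof (rule nn_integral_mono)
        fix x assume "x \<in> space M"
        show "ennreal (norm (f k x - g x)) \<le> ennreal (norm (f k x)) * indicator S x
            + ennreal (norm (g x)) * indicator S x + ennreal h * indicator E x"
        proof (cases "x \<in> S")
          case True
          then have "ennreal (norm (f k x - g x))
              \<le> ennreal (norm (f k x)) * indicator S x + ennreal (norm (g x)) * indicator S x"
            by (auto simp: ennreal_plus[symmetric] norm_triangle_ineq4 simp del: ennreal_plus)
          then show ?thesis by (rule order_trans) simp
        next
          case False
          then show ?thesis
            using \<open>x \<in> space M\<close> by (auto simp: S_def B_def not_less intro!: ennreal_leI)
        qed
      qed
      also have "\<dots> = (\<integral>\<^sup>+x\<in>S. ennreal (norm (f k x)) \<partial>M)
          + (\<integral>\<^sup>+x\<in>S. ennreal (norm (g x)) \<partial>M) + ennreal h * emeasure M E"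
        by (simp add: nn_integral_add nn_integral_cmult_indicator)
      also note *
      also have "(ennreal e + ennreal e) + (ennreal e + ennreal e) + ennreal e = ennreal (5 * e)"
        using e by (simp add: ennreal_plus[symmetric] del: ennreal_plus)
      also note e(2)
      finally show "(\<integral>\<^sup>+x. ennreal (norm (f k x - g x)) \<partial>M) < a" .
    qed
  qed simp
  then show "(\<lambda>k. LINT x|M. f k x) \<longlonglongrightarrow> (LINT x|M. g x)"
    using int g by (intro tendsto_L1_int) auto
qed

section \<open>Baire category and uniform boundedness in Frechet spaces\<close>

context frechet_space
begin

lemma closed_of_sequential:
  fixes S :: "'z set"
  assumes "\<And>s l. (\<And>n. s n \<in> S) \<Longrightarrow> s \<longlonglongrightarrow> l \<Longrightarrow> l \<in> S"
  shows "closed S"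
proof -
  obtain X d where "Metric_space X d" and eq: "(euclidean :: 'z topology) = Metric_space.mtopology X d"
    using metrizable unfolding metrizable_space_def by blast
  then interpret Metric_space X d by simp
  have "X = UNIV" using eq topspace_mtopology by (metis topspace_euclidean)
  then have "closedin mtopology S"
    unfolding metric_closedin_iff_sequentially_closed
    unfolding eq[symmetric]
    using \<open>X = UNIV\<close> by (auto intro: assms)
  then show ?thesis by (simp add: eq[symmetric])
qed

lemma countable_nhds_0:
  obtains B :: "nat \<Rightarrow> 'z set"
  where "\<And>n. open (B n)" "\<And>n. 0 \<in> B n" "\<And>U. open U \<Longrightarrow> 0 \<in> U \<Longrightarrow> \<exists>n. \<forall>m\<ge>n. B m \<subseteq> U"
proof -
  obtain X d where "Metric_space X d" and eq: "(euclidean :: 'z topology) = Metric_space.mtopology X d"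
    using metrizable unfolding metrizable_space_def by blast
  then interpret Metric_space X d by simp
  have X: "X = UNIV" using eq topspace_mtopology by (metis topspace_euclidean)
  show thesis
  proof (rule that[of "\<lambda>n. mball 0 (inverse (Suc n))"])
    show "open (mball 0 (inverse (Suc n)))" for n
      using openin_mball eq by (metis open_openin)
    have "(0 :: 'z) \<in> X" using X by blast
    then show "0 \<in> mball 0 (inverse (Suc n))" for n
      by (simp del: of_nat_Suc)
    fix U :: "'z set" assume "open U" "0 \<in> U"
    then obtain r where r: "r > 0" "mball 0 r \<subseteq> U"
      using eq openin_mtopology by (metis open_openin)
    then obtain n where n: "inverse (real (Suc n)) < r"
      using reals_Archimedean by blast
    have "mball 0 (inverse (Suc m)) \<subseteq> U" if "m \<ge> n" for m
    proof -
      have "inverse (real (Suc m)) \<le> inverse (real (Suc n))"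
        using that by (simp add: field_simps)
      then have "mball 0 (inverse (Suc m)) \<subseteq> mball 0 r"
        using n by (intro mball_subset_concentric) linarith
      then show ?thesis using r(2) by (rule order_trans)
    qed
    then show "\<exists>n. \<forall>m\<ge>n. mball 0 (inverse (Suc m)) \<subseteq> U" by blast
  qed
qed

text \<open>
  The Baire category theorem. Completeness is assumed for the uniformity of the group and
  not for a metric, so the nested sets \<open>P n\<close> of the usual proof are made small by bounding
  their difference sets \<open>P n - P n\<close>, not their diameters.
\<close>

lemma baire:
  fixes C :: "nat \<Rightarrow> 'z set"
  assumes clo: "\<And>n. closed (C n)" and cover: "(\<Union>n. C n) = UNIV"
  shows "\<exists>n. interior (C n) \<noteq> {}"
proof (rule ccontr)
  assume "\<not> ?thesis"
  then have empty: "interior (C n) = {}" for n by blast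
  obtain B :: "nat \<Rightarrow> 'z set" where B: "\<And>n. open (B n)" "\<And>n. 0 \<in> B n"
    and B_base: "\<And>U. open U \<Longrightarrow> 0 \<in> U \<Longrightarrow> \<exists>n. \<forall>m\<ge>n. B m \<subseteq> U"
    using countable_nhds_0 by blast
  have regular: "regular_space (euclidean :: 'z topology)"
    using metrizable by (rule metrizable_imp_regular_space)
  \<comment> \<open>Regularity gives a small open set whose closure avoids \<open>C n\<close>; continuity of subtraction
    at \<open>(a, a)\<close> makes its difference set small.\<close>
  have step: "\<exists>P'. (open P' \<and> P' \<noteq> {}) \<and>
      (closure P' \<subseteq> P - C n \<and> (\<forall>x\<in>P'. \<forall>y\<in>P'. x - y \<in> B n))"
    if P: "open P \<and> P \<noteq> {}" for P and n
  proof -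
    have "\<not> P \<subseteq> C n"
      using P empty[of n] interior_maximal by blast
    then obtain a where a: "a \<in> P - C n" by blast
    have "open (P - C n)" using P clo by blast
    then obtain U V where UV: "open U" "open V" "a \<in> U" "- (P - C n) \<subseteq> V" "U \<inter> V = {}"
      using regular a unfolding regular_space_def disjnt_def
      by (simp only: open_openin[symmetric] closed_closedin[symmetric] topspace_euclidean)
        (metis Compl_iff DiffI UNIV_I closed_Compl)
    have "((\<lambda>z. fst z - snd z) \<longlongrightarrow> fst (a, a) - snd (a, a)) (nhds (a, a))"
      by (intro tendsto_intros filterlim_ident)
    then have "\<forall>\<^sub>F z in nhds (a, a). fst z - snd z \<in> B n"
      using B by (intro topological_tendstoD) auto
    then obtain W where W: "open W" "(a, a) \<in> W" "\<And>z. z \<in> W \<Longrightarrow> fst z - snd z \<in> B n"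
      unfolding eventually_nhds by blast
    obtain W1 W2 where W12: "open W1" "open W2" "a \<in> W1" "a \<in> W2" "W1 \<times> W2 \<subseteq> W"
      using open_prod_elim[OF W(1,2)] by (metis mem_Sigma_iff)
    define P' where "P' = U \<inter> W1 \<inter> W2"
    have "open P'" "a \<in> P'" using UV W12 by (auto simp: P'_def)
    have "closure P' \<subseteq> - V"
      using UV by (intro closure_minimal) (auto simp: P'_def)
    then have "closure P' \<subseteq> P - C n" using UV by blast
    moreover have "x - y \<in> B n" if "x \<in> P'" "y \<in> P'" for x y
      using W(3)[of "(x, y)"] W12 that by (auto simp: P'_def)
    ultimately show ?thesis using \<open>open P'\<close> \<open>a \<in> P'\<close> by blast
  qed
  obtain P where P: "\<And>n. open (P n) \<and> P n \<noteq> {}"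
    and P_step: "\<And>n. closure (P (Suc n)) \<subseteq> P n - C n \<and>
                   (\<forall>x\<in>P (Suc n). \<forall>y\<in>P (Suc n). x - y \<in> B n)"
    using dependent_nat_choice[of "\<lambda>_ P. open P \<and> P \<noteq> {}"
        "\<lambda>n P P'. closure P' \<subseteq> P - C n \<and> (\<forall>x\<in>P'. \<forall>y\<in>P'. x - y \<in> B n)"]
      step by (metis UNIV_not_empty open_UNIV)
  have "P (Suc n) \<subseteq> P n" for n
    using P_step[of n] closure_subset by blast
  then have anti: "P n \<subseteq> P m" if "m \<le> n" for m n
    using that by (rule lift_Suc_antimono_le)
  have "\<exists>x. x \<in> P n" for n using P by blast
  then obtain s where s: "\<And>n. s n \<in> P n" by metis
  have "\<exists>N. \<forall>m\<ge>N. \<forall>n\<ge>N. s m - s n \<in> U" if "open U" "0 \<in> U" for U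
  proof -
    obtain N where "B N \<subseteq> U" using B_base[OF \<open>open U\<close> \<open>0 \<in> U\<close>] by blast
    then have "s m - s n \<in> U" if "m \<ge> Suc N" "n \<ge> Suc N" for m n
      using P_step[of N] s[of m] s[of n] anti[OF that(1)] anti[OF that(2)] by blast
    then show ?thesis by blast
  qed
  then obtain l where l: "s \<longlonglongrightarrow> l" using complete by blast
  have "l \<in> closure (P (Suc n))" for n
  proof (rule Lim_in_closed_set[OF closed_closure _ _ l])
    show "\<forall>\<^sub>F k in sequentially. s k \<in> closure (P (Suc n))"
      unfolding eventually_sequentially using s anti closure_subset by blast
  qed simp
  then have "l \<notin> C n" for n using P_step[of n] by blast
  then show False using cover by blast
qed

text \<open>A uniform boundedness principle for subadditive functions.\<close>

lemma locally_bounded_of_closed_sublevels: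
  fixes p :: "'z \<Rightarrow> real"
  assumes sub: "\<And>x y. p (x + y) \<le> p x + p y"
    and clo: "\<And>c. closed {z. p z \<le> c}"
  shows "\<exists>C V. open V \<and> 0 \<in> V \<and> (\<forall>z\<in>V. p z \<le> C)"
proof -
  have "(\<Union>n. {z. p z \<le> real n}) = UNIV"
    using real_arch_simple by auto
  then obtain n where "interior {z. p z \<le> real n} \<noteq> {}"
    using baire[of "\<lambda>n. {z. p z \<le> real n}"] clo by blast
  then obtain a where a: "a \<in> interior {z. p z \<le> real n}" by blast
  define V where "V = (\<lambda>z. a + z) -` interior {z. p z \<le> real n}"
  have "open V"
    unfolding V_def by (intro open_vimage continuous_intros) simp
  moreover have "0 \<in> V" using a by (simp add: V_def)
  moreover have "p z \<le> real n + p (- a)" if "z \<in> V" for z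
  proof -
    have "p (a + z) \<le> real n"
      using that interior_subset by (auto simp: V_def)
    then show ?thesis using sub[of "a + z" "- a"] by simp
  qed
  ultimately show ?thesis by blast
qed

lemma in_dual_of_locally_bounded:
  fixes F :: "'z \<Rightarrow> 'f"
  assumes lin: "Vector_Spaces.linear smul (*) F"
    and V: "open V" "0 \<in> V" "\<And>z. z \<in> V \<Longrightarrow> norm (F z) \<le> C"
  shows "F \<in> topological_dual smul"
proof -
  interpret lin: Vector_Spaces.linear smul "(*)" F by (rule lin)
  have "continuous_on UNIV F"
    unfolding continuous_on_def
  proof
    fix z
    have "(F \<longlongrightarrow> F z) (nhds z)"
    proof (rule tendstoI)
      fix e :: real assume "e > 0"
      \<comment> \<open>Scaling by \<open>c\<close> turns the bound \<open>C\<close> on \<open>V\<close> into a bound below \<open>e\<close>.\<close>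
      define c where "c = (\<bar>C\<bar> + 1) / e"
      have "c > 0" using \<open>e > 0\<close> by (simp add: c_def)
      define U where "U = (\<lambda>w. smul (of_real c) (w - z)) -` V"
      have "continuous_on UNIV ((\<lambda>(a, z). smul a z) \<circ> (\<lambda>w. (of_real c, w - z)))"
        by (intro continuous_on_compose continuous_on_subset[OF continuous_smul] continuous_intros) simp
      then have "continuous_on UNIV (\<lambda>w. smul (of_real c) (w - z))"
        by (simp add: o_def)
      then have "open U" unfolding U_def using V(1) by (simp add: open_vimage)
      moreover have "z \<in> U" using V(2) by (simp add: U_def)
      moreover have "dist (F w) (F z) < e" if "w \<in> U" for w
      proof -
        have "norm (F (smul (of_real c) (w - z))) \<le> C"
          using that V(3) by (simp add: U_def)
        then have "c * norm (F w - F z) \<le> C"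
          using \<open>c > 0\<close> by (simp add: lin.scale lin.diff norm_mult)
        then have "(\<bar>C\<bar> + 1) * norm (F w - F z) \<le> C * e"
          using \<open>e > 0\<close> by (simp add: c_def field_simps)
        also have "\<dots> < (\<bar>C\<bar> + 1) * e"
          using \<open>e > 0\<close> by (simp add: mult_strict_right_mono)
        finally show ?thesis by (simp add: dist_norm mult_less_cancel_left)
      qed
      ultimately show "\<forall>\<^sub>F w in nhds z. dist (F w) (F z) < e"
        unfolding eventually_nhds by blast
    qed
    then show "(F \<longlongrightarrow> F z) (at z)"
      by (rule tendsto_mono[rotated]) (simp add: at_within_def)
  qed
  then show ?thesis
    unfolding topological_dual_def using lin by blast
qed

section \<open>Gelfand integrals and weak star convergence\<close>

lemma gelfand_integral_in_dual:
  fixes \<phi> :: "'m \<Rightarrow> 'z \<Rightarrow> 'f"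
  assumes dual: "\<phi> \<in> space M \<rightarrow> topological_dual smul"
    and gelfand: "gelfand_integrable M \<phi>" and E: "E \<in> sets M"
  shows "gelfand_integral M E \<phi> \<in> topological_dual smul"
proof -
  have int: "integrable M (\<lambda>x. \<phi> x z)" for z
    using gelfand by (simp add: gelfand_integrable_def)
  have lin: "Vector_Spaces.linear smul (*) (\<phi> x)" and cont: "continuous_on UNIV (\<phi> x)"
    if "x \<in> space M" for x
    using dual that by (auto simp: topological_dual_def)
  have add: "\<phi> x (y + z) = \<phi> x y + \<phi> x z" and homog: "\<phi> x (smul a z) = a * \<phi> x z"
    if "x \<in> space M" for x y z a
    using lin[OF that] by (simp_all add: Vector_Spaces.linear_iff)
  \<comment> \<open>The seminorm that dominates all Gelfand integrals of \<open>\<phi>\<close>.\<close>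
  define p where "p z = (LINT x|M. norm (\<phi> x z))" for z
  have p_nn: "(\<integral>\<^sup>+x. ennreal (norm (\<phi> x z)) \<partial>M) = ennreal (p z)" for z
    unfolding p_def using int by (intro nn_integral_eq_integral) auto
  have p_nonneg: "p z \<ge> 0" for z by (simp add: p_def)
  have "p (y + z) \<le> p y + p z" for y z
  proof -
    have "p (y + z) \<le> (LINT x|M. norm (\<phi> x y) + norm (\<phi> x z))"
      unfolding p_def using int by (intro integral_mono) (auto simp: add norm_triangle_ineq)
    then show ?thesis using int by (simp add: p_def)
  qed
  moreover have "closed {z. p z \<le> c}" for c
  proof (rule closed_of_sequential)
    fix s l assume s: "\<And>n. s n \<in> {z. p z \<le> c}" and l: "s \<longlonglongrightarrow> l"
    have "(\<integral>\<^sup>+x. ennreal (norm (\<phi> x l)) \<partial>M) \<le> ennreal c"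
    proof (rule nn_integral_le_of_tendsto[where u = "\<lambda>n x. ennreal (norm (\<phi> x (s n)))"])
      show "(\<lambda>x. ennreal (norm (\<phi> x (s n)))) \<in> borel_measurable M" for n
        using int[of "s n"] by measurable
      show "AE x in M. (\<lambda>n. ennreal (norm (\<phi> x (s n)))) \<longlonglongrightarrow> ennreal (norm (\<phi> x l))"
        by (intro AE_I2 tendsto_ennrealI tendsto_norm continuous_on_tendsto_compose[OF cont l]) auto
      show "(\<integral>\<^sup>+x. ennreal (norm (\<phi> x (s n))) \<partial>M) \<le> ennreal c" for n
        using s by (simp add: p_nn ennreal_leI)
    qed
    moreover have "0 \<le> c" using s[of 0] p_nonneg[of "s 0"] by simp
    ultimately show "l \<in> {z. p z \<le> c}" by (simp add: p_nn)
  qed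
  ultimately have "\<exists>C V. open V \<and> 0 \<in> V \<and> (\<forall>z\<in>V. p z \<le> C)"
    by (rule locally_bounded_of_closed_sublevels)
  then obtain C V where V: "open V" "0 \<in> V" "\<And>z. z \<in> V \<Longrightarrow> p z \<le> C"
    by blast
  have in_space: "x \<in> space M" if "x \<in> E" for x
    using that E sets.sets_into_space by blast
  have set_int: "set_integrable M E (\<lambda>x. \<phi> x z)" for z
    unfolding set_integrable_def using E int by (rule integrable_mult_indicator)
  have "norm (gelfand_integral M E \<phi> z) \<le> p z" for z
  proof -
    have "norm (gelfand_integral M E \<phi> z) \<le> (LINT x|M. norm (indicat_real E x *\<^sub>R \<phi> x z))"
      unfolding gelfand_integral_def set_lebesgue_integral_def by (rule integral_norm_bound)
    also have "\<dots> \<le> p z"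
      unfolding p_def using int set_int[unfolded set_integrable_def]
      by (intro integral_mono integrable_norm) (auto simp: indicator_def)
    finally show ?thesis .
  qed
  then have bound: "norm (gelfand_integral M E \<phi> z) \<le> C" if "z \<in> V" for z
    using V(3)[OF that] order_trans by blast
  have "gelfand_integral M E \<phi> (y + z)
      = gelfand_integral M E \<phi> y + gelfand_integral M E \<phi> z" for y z
  proof -
    have "gelfand_integral M E \<phi> (y + z) = (LINT x:E|M. \<phi> x y + \<phi> x z)"
      unfolding gelfand_integral_def
      using E by (intro set_lebesgue_integral_cong) (auto simp: add in_space)
    then show ?thesis
      using set_int by (simp add: gelfand_integral_def set_integral_add)
  qed
  moreover have "gelfand_integral M E \<phi> (smul a z) = a * gelfand_integral M E \<phi> z" for a z
  proof -
    have "gelfand_integral M E \<phi> (smul a z) = (LINT x:E|M. a * \<phi> x z)"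
      unfolding gelfand_integral_def
      using E by (intro set_lebesgue_integral_cong) (auto simp: homog in_space)
    then show ?thesis by (simp add: gelfand_integral_def)
  qed
  moreover have "vector_space ((*) :: 'f \<Rightarrow> 'f \<Rightarrow> 'f)"
    by unfold_locales (auto simp: algebra_simps)
  ultimately have "Vector_Spaces.linear smul (*) (gelfand_integral M E \<phi>)"
    unfolding Vector_Spaces.linear_iff using vector_space_axioms by blast
  then show ?thesis
    using V(1,2) bound by (rule in_dual_of_locally_bounded)
qed

end

lemma limitin_weak_star_iff:
  "limitin (weak_star_topology smul) F l net \<longleftrightarrow>
     l \<in> topological_dual smul \<and> (\<forall>\<^sub>F k in net. F k \<in> topological_dual smul) \<and>
     (\<forall>z. ((\<lambda>k. F k z) \<longlongrightarrow> l z) net)" (is "?L \<longleftrightarrow> ?R")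
proof
  assume L: ?L
  have "((\<lambda>k. F k z) \<longlongrightarrow> l z) net" for z
    using continuous_map_limit[OF continuous_map_weak_star_eval L, of z] by (simp add: o_def)
  moreover have "\<forall>\<^sub>F k in net. F k \<in> topological_dual smul"
    using L openin_topspace unfolding limitin_def topspace_weak_star_topology[symmetric] by blast
  ultimately show ?R
    using limitin_topspace[OF L] by (simp add: topspace_weak_star_topology)
next
  assume R: ?R
  have "\<forall>\<^sub>F k in net. F k \<in> W"
    if "generate_topology_on {{z' \<in> topological_dual smul. z' z \<in> U} | z U. open U} W" "l \<in> W" for W
    using that
  proof (induction rule: generate_topology_on.induct)
    case (Basis W)
    then obtain z U where W: "W = {z' \<in> topological_dual smul. z' z \<in> U}" "open U" by blast
    then have "\<forall>\<^sub>F k in net. F k z \<in> U"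
      using R Basis by (intro topological_tendstoD[of _ "l z"]) auto
    with R show ?case unfolding W by (auto elim: eventually_elim2)
  next
    case (UN K)
    then obtain k where k: "k \<in> K" "l \<in> k" by blast
    then have "\<forall>\<^sub>F i in net. F i \<in> k" by (rule UN.IH)
    then show ?case by (rule eventually_mono) (use k in blast)
  qed (auto intro: eventually_conj)
  then show ?L
    using R unfolding limitin_def topspace_weak_star_topology
    unfolding weak_star_topology_def openin_topology_generated_by_iff by blast
qed

theorem theorem3p10:
  fixes M :: "'m measure"
    and smul :: "'f::rc_field \<Rightarrow> 'z::topological_ab_group_add \<Rightarrow> 'z"
    and \<psi>s :: "nat \<Rightarrow> 'm \<Rightarrow> 'z \<Rightarrow> 'f"
    and \<psi> :: "'m \<Rightarrow> 'z \<Rightarrow> 'f"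
  assumes "sigma_finite_measure M"
    and "frechet_space smul"
    and "\<And>k. \<psi>s k \<in> space M \<rightarrow> topological_dual smul"
    and "\<psi> \<in> space M \<rightarrow> topological_dual smul"
    and "\<And>k. gelfand_integrable M (\<psi>s k)"
    and "\<And>z. (\<lambda>x. \<psi> x z) \<in> borel_measurable M"
    and "AE x in M. limitin (weak_star_topology smul) (\<lambda>k. \<psi>s k x) (\<psi> x) sequentially"
    and "\<And>z \<epsilon>. (\<epsilon>::real) > 0 \<Longrightarrow>
           \<exists>E\<in>sets M. emeasure M E < \<infinity> \<and>
             (\<forall>G\<in>sets M. G \<inter> E = {} \<longrightarrow>
               (SUP k. \<integral>\<^sup>+x\<in>G. ennreal (norm (\<psi>s k x z)) \<partial>M) < ennreal \<epsilon>)"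
    and "\<And>z \<epsilon>. (\<epsilon>::real) > 0 \<Longrightarrow>
           \<exists>\<delta>::real. \<delta> > 0 \<and>
             (\<forall>E\<in>sets M. emeasure M E < ennreal \<delta> \<longrightarrow>
               (SUP k. \<integral>\<^sup>+x\<in>E. ennreal (norm (\<psi>s k x z)) \<partial>M) < ennreal \<epsilon>)"
  shows "gelfand_integrable M \<psi> \<and>
         limitin (weak_star_topology smul)
           (\<lambda>k. gelfand_integral M (space M) (\<psi>s k))
           (gelfand_integral M (space M) \<psi>) sequentially"
proof -
  interpret frechet_space smul by fact
  have int: "integrable M (\<lambda>x. \<psi>s k x z)" for k z
    using assms(5) by (simp add: gelfand_integrable_def)
  have lim: "AE x in M. (\<lambda>k. \<psi>s k x z) \<longlonglongrightarrow> \<psi> x z" for z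
    using assms(7) by (rule eventually_mono) (simp add: limitin_weak_star_iff)
  have le: "(\<integral>\<^sup>+x\<in>A. ennreal (norm (\<psi>s k x z)) \<partial>M) \<le> c"
    if "(SUP k. \<integral>\<^sup>+x\<in>A. ennreal (norm (\<psi>s k x z)) \<partial>M) < c" for A k z c
    using SUP_lessD[OF that UNIV_I] by (rule less_imp_le)
  have tight: "\<exists>E\<in>sets M. emeasure M E < \<infinity> \<and> (\<forall>G\<in>sets M. G \<inter> E = {} \<longrightarrow>
        (\<forall>k. (\<integral>\<^sup>+x\<in>G. ennreal (norm (\<psi>s k x z)) \<partial>M) \<le> ennreal e))"
    if "e > 0" for e :: real and z
    using assms(8)[OF that, of z] by (blast intro: le)
  have unif: "\<exists>d::real. d > 0 \<and> (\<forall>E\<in>sets M. emeasure M E < ennreal d \<longrightarrow>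
        (\<forall>k. (\<integral>\<^sup>+x\<in>E. ennreal (norm (\<psi>s k x z)) \<partial>M) \<le> ennreal e))"
    if "e > 0" for e :: real and z
    using assms(9)[OF that, of z] by (blast intro: le)
  have vitali: "integrable M (\<lambda>x. \<psi> x z)"
      "(\<lambda>k. LINT x|M. \<psi>s k x z) \<longlonglongrightarrow> (LINT x|M. \<psi> x z)" for z
    by (rule vitali_convergence[OF int assms(6) lim tight unif], assumption+)+
  from vitali(1) have gelfand: "gelfand_integrable M \<psi>"
    by (simp add: gelfand_integrable_def)
  have "gelfand_integral M (space M) \<phi> z = (LINT x|M. \<phi> x z)" if "gelfand_integrable M \<phi>"
    for \<phi> :: "'m \<Rightarrow> 'z \<Rightarrow> 'f" and z
    using that by (simp add: gelfand_integral_def gelfand_integrable_def set_integral_space)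
  then have "(\<lambda>k. gelfand_integral M (space M) (\<psi>s k) z)
      \<longlonglongrightarrow> gelfand_integral M (space M) \<psi> z" for z
    using vitali(2) gelfand assms(5) by simp
  moreover have "gelfand_integral M (space M) \<psi> \<in> topological_dual smul"
    using assms(4) gelfand sets.top by (rule gelfand_integral_in_dual)
  moreover have "gelfand_integral M (space M) (\<psi>s k) \<in> topological_dual smul" for k
    using assms(3,5) sets.top by (rule gelfand_integral_in_dual)
  ultimately show ?thesis
    using gelfand by (simp add: limitin_weak_star_iff)
qed

end
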